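(* Let $\mathcal{A}$ be an alternating $\mathsf{Val}$ automaton realizing a function $f$ (on finite or on infinite words). If $\mathcal{A}$ is threshold history deterministic, then $\mathcal{A}$ is good for threshold games.
   Context: **Games.** Let $\Sigma$ be a finite nonempty alphabet. An arena is $(V,E,V_E,V_A,L)$ with a (possibly infinite) set $V$ of positions partitioned into Eve's positions $V_E$ and Adam's positions $V_A$, an initial position, edges $E\subseteq V\times V$ and labels $L:E\to\Sigma\cup\{\varepsilon\}$. In infinite-duration games every position has an outgoing edge. A play is a maximal path from the initial position; its non-$\varepsilon$ labels form a word. An $f$ game is an arena with payoff function $f$ (with $f:\Sigma^*\to\mathbb{R}$ or $f:\Sigma^\omega\to\mathbb{R}$; plays are assumed to induce words in the domain of $f$); the payoff of a play is the $f$-value of its word. Strategies map partial plays ending in a position of the respective player to an outgoing edge. The value of an Eve strategy is the infimum of payoffs over plays agreeing with it, and the value of an Adam strategy is the supremum. The game is determined if (sup over Eve strategies of their values) $=$ (inf over Adam strategies of their values); this number is the value of the game. Eve wins the $t$-threshold game on $G$ if the value of $G$ is at least $t$; otherwise Adam wins it. Standing assumption: all games considered (including product games) are determined. **Automata.** An alternating quantitative automaton is $\mathcal{A}=(\Sigma,Q,\iota,\delta)$ with finite nonempty state set $Q$, initial state $\iota\in Q$, and $\delta:Q\times\Sigma\to \mathsf{B}^+(\mathbb{Q}\times Q)$, where $\mathsf{B}^+(\mathbb{Q}\times Q)$ is the set of positive Boolean formulas over (rational weight, state) pairs; it is total (each $\delta(q,a)$ contains at least one pair). A $\mathsf{Val}$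 automaton is one equipped with a value function $\mathsf{Val}:\mathbb{Q}^*\to\mathbb{R}$ (finite words) or $\mathsf{Val}:\mathbb{Q}^\omega\to\mathbb{R}$ (infinite words). For a word $w$, the game $G(\mathcal{A},w)$ is played letter by letter from $\iota$: in state $q$ with next letter $a$, Eve resolves the disjunctions and Adam the conjunctions of $\delta(q,a)$ until a pair $(x,q')$ is reached; weight $x$ is output and the state becomes $q'$. The payoff is $\mathsf{Val}$ of the output weight sequence. The value $\mathcal{A}(w)$ is the value of this game; $\mathcal{A}$ realizes the function $w\mapsto\mathcal{A}(w)$ if this game is determined for all $w$. Only automata realizing functions are considered. **Product.** For a $\Sigma$-labelled game $G$ and an automaton $\mathcal{A}$ over $\Sigma$, the product game $G\times\mathcal{A}$ starts in (initial position of $G$, $\iota$). From $(v,q)$ the owner of $v$ in $G$ picks an edge $(v,v')$; if it is labelled $\varepsilon$ the game moves to $(v',q)$; if it is labelled $a\in\Sigma$, then Eve resolves the disjunctions and Adam the conjunctions of $\delta(q,a)$ until a pair $(x,q')$ is reached, weight $x$ is output, and the game moves to $(v',q')$. The payoff is $\mathsf{Val}$ of the output weight sequence. **Good for threshold games.** Let $\mathcal{A}$ realize $f$. For $t\in\mathbb{R}$, $\mathcal{A}$ is good for $t$-threshold games if for every determined game $G$ with a $\Sigma$-labelled arena and payoff function $f$, Eve wins the $t$-threshold game on $G$ if and only if she wins the $t$-threshold game on $G\times\mathcal{A}$. $\mathcal{A}$ is good for threshold games if this holds for all $t\in\mathbb{R}$. **Threshold history determinism.** Eve's letter game on $\mathcal{A}$: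 starting from $\iota$, repeatedly, in state $q$ Adam picks a letter $a\in\Sigma$, then Eve resolves the disjunctions and Adam the conjunctions of $\delta(q,a)$, yielding a transition with some weight and a new state. An infinite play yields an infinite word $w$ and an infinite sequence $\pi$ of transitions; $\mathsf{Val}(\pi)$ denotes $\mathsf{Val}$ of its weight sequence. In Eve's $t$-threshold letter game, for infinite words Eve wins the play if $\mathcal{A}(w)\ge t\implies\mathsf{Val}(\pi)\ge t$; for finite words she wins if for all $i$, $\mathcal{A}(w[0..i])\ge t\implies\mathsf{Val}(\pi[0..i])\ge t$. Adam's $t$-threshold letter game is the same except that Eve picks the letters, and Adam wins the play if $\mathcal{A}(w)<t\implies\mathsf{Val}(\pi)<t$ (for finite words: if this holds for all prefixes $w[0..i],\pi[0..i]$). A player wins a letter game if they have a strategy such that all plays agreeing with it are won by them. $\mathcal{A}$ is $t$-threshold history deterministic if Eve wins Eve's and Adam wins Adam's $t$-threshold letter game, and threshold history deterministic if this holds for all $t\in\mathbb{R}$. *)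

theory Defs
  imports Complex_Main "HOL-Library.Extended_Real" "HOL-Library.Infinite_Set"
begin

section \<open>Words and functions on words\<close>

text \<open>Finite and infinite sequences; used both for words and for plays.\<close>

datatype 'x seq = Fin "'x list" | Inf "nat \<Rightarrow> 'x"

text \<open>
  Real-valued functions on finite words or on infinite words.  They serve both as payoff functions
  of games and as value functions of automata.
\<close>

datatype 'x wordfun =
    On_finite "'x list \<Rightarrow> real"
  | On_infinite "(nat \<Rightarrow> 'x) \<Rightarrow> real"

fun on_finite :: "'x wordfun \<Rightarrow> bool" where
  "on_finite (On_finite f) = True"
| "on_finite (On_infinite f) = False"

fun word_domain :: "'x wordfun \<Rightarrow> 'x seq set" where
  "word_domain (On_finite f) = range Fin"
| "word_domain (On_infinite f) = range Inf"

text \<open>Only meaningful on words in \<^term>\<open>word_domain F\<close>.\<close>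

fun payoff :: "'x wordfun \<Rightarrow> 'x seq \<Rightarrow> real" where
  "payoff (On_finite f) (Fin w) = f w"
| "payoff (On_infinite f) (Inf w) = f w"
| "payoff (On_finite f) (Inf w) = undefined"
| "payoff (On_infinite f) (Fin w) = undefined"


section \<open>Games\<close>

text \<open>Label \<^term>\<open>None\<close> is the empty label; labels matter on edges only.\<close>

record ('v, 'l) arena =
  eve_pos :: "'v set"
  adam_pos :: "'v set"
  init_pos :: 'v
  edges :: "('v \<times> 'v) set"
  label :: "'v \<times> 'v \<Rightarrow> 'l option"

definition positions :: "('v, 'l) arena \<Rightarrow> 'v set" where
  "positions G = eve_pos G \<union> adam_pos G"

definition wf_arena :: "('v, 'l) arena \<Rightarrow> bool" where
  "wf_arena G \<longleftrightarrow> eve_pos G \<inter> adam_pos G = {} \<and> init_pos G \<in> positions G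
     \<and> edges G \<subseteq> positions G \<times> positions G"

definition partial_play :: "('v, 'l) arena \<Rightarrow> 'v list \<Rightarrow> bool" where
  "partial_play G h \<longleftrightarrow> h \<noteq> [] \<and> hd h = init_pos G
     \<and> (\<forall>i. Suc i < length h \<longrightarrow> (h ! i, h ! Suc i) \<in> edges G)"

text \<open>Plays are the maximal paths: infinite, or finite and ending in a dead end.\<close>

fun is_play :: "('v, 'l) arena \<Rightarrow> 'v seq \<Rightarrow> bool" where
  "is_play G (Fin h) \<longleftrightarrow> partial_play G h \<and> (\<forall>v. (last h, v) \<notin> edges G)"
| "is_play G (Inf p) \<longleftrightarrow> p 0 = init_pos G \<and> (\<forall>i. (p i, p (Suc i)) \<in> edges G)"

text \<open>
  The word of non-empty labels along a play.  An infinite play with only finitely many labelled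
  edges induces a finite word.
\<close>

fun play_word :: "('v, 'l) arena \<Rightarrow> 'v seq \<Rightarrow> 'l seq" where
  "play_word G (Fin h) = Fin (List.map_filter (label G) (zip h (tl h)))"
| "play_word G (Inf p) =
     (let S = {i. label G (p i, p (Suc i)) \<noteq> None};
          x = (\<lambda>i. the (label G (p i, p (Suc i))))
      in if finite S then Fin (map x (sorted_list_of_set S))
         else Inf (\<lambda>n. x (Infinite_Set.enumerate S n)))"

definition is_game :: "('v, 'l) arena \<Rightarrow> 'l wordfun \<Rightarrow> bool" where
  "is_game G F \<longleftrightarrow> wf_arena G
     \<and> (\<forall>p. is_play G p \<longrightarrow> play_word G p \<in> word_domain F)
     \<and> (\<not> on_finite F \<longrightarrow> (\<forall>v \<in> positions G. \<exists>v'. (v, v') \<in> edges G))"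

text \<open>
  A strategy for the player owning the positions \<^term>\<open>P\<close>: it maps a partial play to the endpoint
  of the chosen edge.
\<close>

definition is_strategy :: "('v, 'l) arena \<Rightarrow> 'v set \<Rightarrow> ('v list \<Rightarrow> 'v) \<Rightarrow> bool" where
  "is_strategy G P s \<longleftrightarrow>
     (\<forall>h. partial_play G h \<and> last h \<in> P \<and> (\<exists>v. (last h, v) \<in> edges G)
        \<longrightarrow> (last h, s h) \<in> edges G)"

fun agrees :: "'v set \<Rightarrow> ('v list \<Rightarrow> 'v) \<Rightarrow> 'v seq \<Rightarrow> bool" where
  "agrees P s (Fin h) \<longleftrightarrow>
     (\<forall>i. Suc i < length h \<and> h ! i \<in> P \<longrightarrow> h ! Suc i = s (take (Suc i) h))"
| "agrees P s (Inf p) \<longleftrightarrow> (\<forall>i. p i \<in> P \<longrightarrow> p (Suc i) = s (map p [0..<Suc i]))"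

definition eve_strategies :: "('v, 'l) arena \<Rightarrow> ('v list \<Rightarrow> 'v) set" where
  "eve_strategies G = {s. is_strategy G (eve_pos G) s}"

definition adam_strategies :: "('v, 'l) arena \<Rightarrow> ('v list \<Rightarrow> 'v) set" where
  "adam_strategies G = {s. is_strategy G (adam_pos G) s}"

definition eve_plays :: "('v, 'l) arena \<Rightarrow> ('v list \<Rightarrow> 'v) \<Rightarrow> 'v seq set" where
  "eve_plays G s = {p. is_play G p \<and> agrees (eve_pos G) s p}"

definition adam_plays :: "('v, 'l) arena \<Rightarrow> ('v list \<Rightarrow> 'v) \<Rightarrow> 'v seq set" where
  "adam_plays G s = {p. is_play G p \<and> agrees (adam_pos G) s p}"

text \<open>Values are extended reals, since suprema and infima of real payoffs may be infinite.\<close>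

definition eve_strategy_value ::
    "('v, 'l) arena \<Rightarrow> 'l wordfun \<Rightarrow> ('v list \<Rightarrow> 'v) \<Rightarrow> ereal" where
  "eve_strategy_value G F s = (INF p \<in> eve_plays G s. ereal (payoff F (play_word G p)))"

definition adam_strategy_value ::
    "('v, 'l) arena \<Rightarrow> 'l wordfun \<Rightarrow> ('v list \<Rightarrow> 'v) \<Rightarrow> ereal" where
  "adam_strategy_value G F s = (SUP p \<in> adam_plays G s. ereal (payoff F (play_word G p)))"

definition eve_value :: "('v, 'l) arena \<Rightarrow> 'l wordfun \<Rightarrow> ereal" where
  "eve_value G F = (SUP s \<in> eve_strategies G. eve_strategy_value G F s)"

definition adam_value :: "('v, 'l) arena \<Rightarrow> 'l wordfun \<Rightarrow> ereal" where
  "adam_value G F = (INF s \<in> adam_strategies G. adam_strategy_value G F s)"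

definition determined :: "('v, 'l) arena \<Rightarrow> 'l wordfun \<Rightarrow> bool" where
  "determined G F \<longleftrightarrow> eve_value G F = adam_value G F"

text \<open>The value of a game; only used for determined games.\<close>

definition game_value :: "('v, 'l) arena \<Rightarrow> 'l wordfun \<Rightarrow> ereal" where
  "game_value G F = eve_value G F"

definition eve_wins_threshold :: "real \<Rightarrow> ('v, 'l) arena \<Rightarrow> 'l wordfun \<Rightarrow> bool" where
  "eve_wins_threshold t G F \<longleftrightarrow> ereal t \<le> game_value G F"


section \<open>Alternating quantitative automata\<close>

text \<open>
  Positive Boolean formulas.  There are no constants, so every formula contains an atom and
  transition functions are total.
\<close>

datatype 'x pbf = Atom 'x | Conj "'x pbf" "'x pbf" | Disj "'x pbf" "'x pbf"

text \<open>
  Alphabet and state set are the types \<open>'a\<close> and \<open>'q\<close>, which are to be of class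
  \<^class>\<open>finite\<close>.
\<close>

record ('a, 'q) automaton =
  init_state :: 'q
  trans :: "'q \<Rightarrow> 'a \<Rightarrow> (rat \<times> 'q) pbf"
  val_fun :: "rat wordfun"

text \<open>
  Positions of games in which transition conditions are resolved: \<open>State s\<close> between two transitions,
  and \<open>Resolve c \<phi>\<close> while the subformula \<open>\<phi>\<close> remains to be resolved in context \<open>c\<close>.
\<close>

datatype ('s, 'c, 'q) res_pos = State 's | Resolve 'c "(rat \<times> 'q) pbf"

text \<open>
  Eve moves at disjunctions and Adam at conjunctions.  An atom has a single outgoing edge (added
  by the games below), so its owner is irrelevant.
\<close>

definition resolve_eve :: "'c set \<Rightarrow> ('s, 'c, 'q) res_pos set" where
  "resolve_eve C = {Resolve c (Disj \<phi> \<psi>) |c \<phi> \<psi>. c \<in> C} \<union> {Resolve c (Atom y) |c y. c \<in> C}"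

definition resolve_adam :: "'c set \<Rightarrow> ('s, 'c, 'q) res_pos set" where
  "resolve_adam C = {Resolve c (Conj \<phi> \<psi>) |c \<phi> \<psi>. c \<in> C}"

definition resolve_edges :: "'c set \<Rightarrow> (('s, 'c, 'q) res_pos \<times> ('s, 'c, 'q) res_pos) set" where
  "resolve_edges C =
     {(Resolve c (Disj \<phi> \<psi>), Resolve c \<chi>) |c \<phi> \<psi> \<chi>. c \<in> C \<and> (\<chi> = \<phi> \<or> \<chi> = \<psi>)}
   \<union> {(Resolve c (Conj \<phi> \<psi>), Resolve c \<chi>) |c \<phi> \<psi> \<chi>. c \<in> C \<and> (\<chi> = \<phi> \<or> \<chi> = \<psi>)}"

subsection \<open>Product of a game and an automaton\<close>

text \<open>
  Taking an edge \<open>(v, v')\<close> labelled by a letter leads to resolving the transition condition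
  in context \<open>v'\<close>.  The only labelled edges of the product are those leaving atoms.
\<close>

fun product_label :: "('s, 'c, 'q) res_pos \<times> ('s, 'c, 'q) res_pos \<Rightarrow> rat option" where
  "product_label (Resolve c (Atom (x, q)), _) = Some x"
| "product_label _ = None"

definition product ::
    "('v, 'a) arena \<Rightarrow> ('a, 'q) automaton \<Rightarrow> (('v \<times> 'q, 'v, 'q) res_pos, rat) arena" where
  "product G A = \<lparr>
     eve_pos = {State (v, q) |v q. v \<in> eve_pos G} \<union> resolve_eve (positions G),
     adam_pos = {State (v, q) |v q. v \<in> adam_pos G} \<union> resolve_adam (positions G),
     init_pos = State (init_pos G, init_state A),
     edges =
         {(State (v, q), State (v', q)) |v v' q. (v, v') \<in> edges G \<and> label G (v, v') = None}
       \<union> {(State (v, q), Resolve v' (trans A q a)) |v v' q a.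
            (v, v') \<in> edges G \<and> label G (v, v') = Some a}
       \<union> resolve_edges (positions G)
       \<union> {(Resolve v (Atom (x, q)), State (v, q)) |v x q. v \<in> positions G},
     label = product_label \<rparr>"

subsection \<open>The value of a word\<close>

fun letter_at :: "'a seq \<Rightarrow> nat \<Rightarrow> 'a option" where
  "letter_at (Fin w) i = (if i < length w then Some (w ! i) else None)"
| "letter_at (Inf w) i = Some (w i)"

text \<open>
  The arena in which the letters of a word are read one after the other.  There is at most one
  move everywhere, so the owner of the positions is irrelevant.
\<close>

definition word_arena :: "'a seq \<Rightarrow> (nat, 'a) arena" where
  "word_arena w = \<lparr>
     eve_pos = {},
     adam_pos = UNIV,
     init_pos = 0,
     edges = {(i, Suc i) |i. letter_at w i \<noteq> None},
     label = (\<lambda>(i, j). letter_at w i) \<rparr>"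

definition word_game ::
    "('a, 'q) automaton \<Rightarrow> 'a seq \<Rightarrow> ((nat \<times> 'q, nat, 'q) res_pos, rat) arena" where
  "word_game A w = product (word_arena w) A"

definition aut_value :: "('a, 'q) automaton \<Rightarrow> 'a seq \<Rightarrow> ereal" where
  "aut_value A w = game_value (word_game A w) (val_fun A)"

definition realizes :: "('a, 'q) automaton \<Rightarrow> 'a wordfun \<Rightarrow> bool" where
  "realizes A f \<longleftrightarrow> (on_finite f \<longleftrightarrow> on_finite (val_fun A))
     \<and> (\<forall>w \<in> word_domain f. determined (word_game A w) (val_fun A)
          \<and> aut_value A w = ereal (payoff f w))"


section \<open>Good for threshold games\<close>

text \<open>
  The definition refers to games whose positions are drawn from the type \<open>'v\<close>; quantification over
  all games is obtained by leaving \<open>'v\<close> arbitrary.  Determinacy of the product is required because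
  its value is only defined in that case.
\<close>

definition good_for_t_threshold_games ::
    "'v itself \<Rightarrow> ('a, 'q) automaton \<Rightarrow> 'a wordfun \<Rightarrow> real \<Rightarrow> bool" where
  "good_for_t_threshold_games T A f t \<longleftrightarrow>
     (\<forall>G :: ('v, 'a) arena.
        is_game G f \<and> determined G f \<and> determined (product G A) (val_fun A) \<longrightarrow>
        (eve_wins_threshold t G f \<longleftrightarrow> eve_wins_threshold t (product G A) (val_fun A)))"

definition good_for_threshold_games ::
    "'v itself \<Rightarrow> ('a, 'q) automaton \<Rightarrow> 'a wordfun \<Rightarrow> bool" where
  "good_for_threshold_games T A f \<longleftrightarrow> (\<forall>t. good_for_t_threshold_games T A f t)"


section \<open>Threshold history determinism\<close>

text \<open>
  The common arena of the letter games, parametrised by whether Adam picks the letters.  A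
  transition is labelled by its letter together with its weight, so that the word of a play
  carries both the word \<open>w\<close> and the weight sequence of \<open>\<pi>\<close>.
\<close>

fun letter_label :: "('q, 'a, 'q) res_pos \<times> ('q, 'a, 'q) res_pos \<Rightarrow> ('a \<times> rat) option" where
  "letter_label (Resolve a (Atom (x, q)), _) = Some (a, x)"
| "letter_label _ = None"

definition letter_arena ::
    "bool \<Rightarrow> ('a, 'q) automaton \<Rightarrow> (('q, 'a, 'q) res_pos, 'a \<times> rat) arena" where
  "letter_arena adam_picks A = \<lparr>
     eve_pos = (if adam_picks then {} else range State) \<union> resolve_eve UNIV,
     adam_pos = (if adam_picks then range State else {}) \<union> resolve_adam UNIV,
     init_pos = State (init_state A),
     edges =
         {(State q, Resolve a (trans A q a)) |q a. True}
       \<union> resolve_edges UNIV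
       \<union> {(Resolve a (Atom (x, q)), State q) |a x q. True},
     label = letter_label \<rparr>"

text \<open>
  The words on which the winning condition is evaluated: the infinite word itself, or all of its
  prefixes \<open>\<rho>[0..i]\<close>.
\<close>

fun tested_words :: "rat wordfun \<Rightarrow> (nat \<Rightarrow> 'x) \<Rightarrow> 'x seq set" where
  "tested_words (On_infinite V) \<rho> = {Inf \<rho>}"
| "tested_words (On_finite V) \<rho> = {Fin (map \<rho> [0..<Suc i]) |i. True}"

definition eve_wins_letter_play ::
    "real \<Rightarrow> ('a, 'q) automaton \<Rightarrow> (nat \<Rightarrow> 'a \<times> rat) \<Rightarrow> bool" where
  "eve_wins_letter_play t A \<rho> \<longleftrightarrow>
     (\<forall>u \<in> tested_words (val_fun A) \<rho>.
        ereal t \<le> aut_value A (map_seq fst u) \<longrightarrow> t \<le> payoff (val_fun A) (map_seq snd u))"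

definition adam_wins_letter_play ::
    "real \<Rightarrow> ('a, 'q) automaton \<Rightarrow> (nat \<Rightarrow> 'a \<times> rat) \<Rightarrow> bool" where
  "adam_wins_letter_play t A \<rho> \<longleftrightarrow>
     (\<forall>u \<in> tested_words (val_fun A) \<rho>.
        aut_value A (map_seq fst u) < ereal t \<longrightarrow> payoff (val_fun A) (map_seq snd u) < t)"

definition eve_wins_eves_letter_game :: "real \<Rightarrow> ('a, 'q) automaton \<Rightarrow> bool" where
  "eve_wins_eves_letter_game t A \<longleftrightarrow>
     (\<exists>s \<in> eve_strategies (letter_arena True A). \<forall>p \<in> eve_plays (letter_arena True A) s.
        \<exists>\<rho>. play_word (letter_arena True A) p = Inf \<rho> \<and> eve_wins_letter_play t A \<rho>)"

definition adam_wins_adams_letter_game :: "real \<Rightarrow> ('a, 'q) automaton \<Rightarrow> bool" where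
  "adam_wins_adams_letter_game t A \<longleftrightarrow>
     (\<exists>s \<in> adam_strategies (letter_arena False A). \<forall>p \<in> adam_plays (letter_arena False A) s.
        \<exists>\<rho>. play_word (letter_arena False A) p = Inf \<rho> \<and> adam_wins_letter_play t A \<rho>)"

definition t_threshold_history_deterministic :: "real \<Rightarrow> ('a, 'q) automaton \<Rightarrow> bool" where
  "t_threshold_history_deterministic t A \<longleftrightarrow>
     eve_wins_eves_letter_game t A \<and> adam_wins_adams_letter_game t A"

definition threshold_history_deterministic :: "('a, 'q) automaton \<Rightarrow> bool" where
  "threshold_history_deterministic A \<longleftrightarrow> (\<forall>t. t_threshold_history_deterministic t A)"

end

theory Submission
  imports Defs "HOL-Library.Sublist"
begin

text \<open>
  A strategy of a player in \<open>G\<close> and a winning strategy of the same player in the letter game with a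
  threshold \<open>t'\<close> are run in parallel on the product: the former chooses the edges of \<open>G\<close>, the latter
  resolves the formulas.  A play of the product thus yields a play of \<open>G\<close> and a play of the letter
  game over the same word, so a guarantee \<open>f(w) \<ge> t'\<close> for Eve (or \<open>f(w) < t'\<close> for Adam) carries over
  to the weight sequence.  As optimal strategies need not exist, Eve uses all \<open>t' < t\<close>, and Adam some
  \<open>t'\<close> strictly between the value of his strategy and \<open>t\<close>.
\<close>

section \<open>Partial plays and their limits\<close>

definition word_of :: "('v, 'l) arena \<Rightarrow> 'v list \<Rightarrow> 'l list" where
  "word_of G h = List.map_filter (label G) (zip h (tl h))"

lemma zip_tl_snoc: "h \<noteq> [] \<Longrightarrow> zip (h @ [y]) (tl (h @ [y])) = zip h (tl h) @ [(last h, y)]"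
  by (induction h rule: list_nonempty_induct) (auto simp: neq_Nil_conv)

lemma map_filter_append: "List.map_filter f (xs @ ys) = List.map_filter f xs @ List.map_filter f ys"
  by (simp add: List.map_filter_def)

lemma word_of_singleton [simp]: "word_of G [v] = []"
  by (simp add: word_of_def)

lemma word_of_snoc:
  "h \<noteq> [] \<Longrightarrow> word_of G (h @ [y])
     = word_of G h @ (case label G (last h, y) of None \<Rightarrow> [] | Some a \<Rightarrow> [a])"
  unfolding word_of_def zip_tl_snoc map_filter_append
  by (auto split: option.split)

lemma length_word_of_le: "length (word_of G h) \<le> length h"
proof -
  have "length (List.map_filter (label G) xs) \<le> length xs" for xs
    by (simp add: List.map_filter_def)
  from le_trans [OF this] show ?thesis
    by (simp add: word_of_def)
qed

lemma prefix_word_of: "prefix h h' \<Longrightarrow> h \<noteq> [] \<Longrightarrow> prefix (word_of G h) (word_of G h')"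
proof (induction h' rule: rev_induct)
  case (snoc y h')
  show ?case
  proof (cases "h = h' @ [y]")
    case False
    then have "prefix h h'" using snoc.prems by auto
    moreover from this snoc.prems have "h' \<noteq> []" by auto
    ultimately show ?thesis
      using snoc by (simp add: word_of_snoc)
  qed simp
qed simp

lemma partial_play_singleton [simp]: "partial_play G [v] \<longleftrightarrow> v = init_pos G"
  by (simp add: partial_play_def)

text \<open>\<open>partial_play\<close> and \<open>agrees\<close> both quantify over the step
  indices of a history; appending one position adds just the index
  \<open>length h - 1\<close>.\<close>

lemma all_steps_snoc:
  assumes "h \<noteq> []"
  shows "(\<forall>i. Suc i < length (h @ [y]) \<longrightarrow> Q i)
     \<longleftrightarrow> (\<forall>i. Suc i < length h \<longrightarrow> Q i) \<and> Q (length h - 1)"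
proof -
  have "Suc i < length (h @ [y]) \<longleftrightarrow> Suc i < length h \<or> i = length h - 1" for i
    using assms by (cases h) auto
  then show ?thesis by blast
qed

lemma partial_play_snoc:
  assumes "h \<noteq> []"
  shows "partial_play G (h @ [y]) \<longleftrightarrow> partial_play G h \<and> (last h, y) \<in> edges G"
  unfolding partial_play_def all_steps_snoc[OF assms]
  using assms by (auto simp: nth_append last_conv_nth)

lemma agrees_singleton [simp]: "agrees P s (Fin [v])"
  by simp

lemma agrees_snoc:
  assumes "h \<noteq> []"
  shows "agrees P s (Fin (h @ [y])) \<longleftrightarrow> agrees P s (Fin h) \<and> (last h \<in> P \<longrightarrow> y = s h)"
proof -
  have eq: "agrees P s (Fin h) \<longleftrightarrow>
      (\<forall>i. Suc i < length h \<longrightarrow> h ! i \<in> P \<longrightarrow> h ! Suc i = s (take (Suc i) h))" for h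
    by auto
  show ?thesis
    unfolding eq all_steps_snoc[OF assms]
    using assms by (auto simp: nth_append last_conv_nth)
qed

lemma partial_play_induct [consumes 1, case_names init step]:
  assumes "partial_play G h"
    and "Q [init_pos G]"
    and "\<And>h y. partial_play G h \<Longrightarrow> (last h, y) \<in> edges G \<Longrightarrow> Q h \<Longrightarrow> Q (h @ [y])"
  shows "Q h"
  using assms(1)
proof (induction h rule: rev_induct)
  case (snoc y h)
  show ?case
  proof (cases "h = []")
    case True
    then show ?thesis using snoc.prems assms(2) by simp
  next
    case False
    then show ?thesis using snoc assms(3) by (simp add: partial_play_snoc)
  qed
qed (simp add: partial_play_def)

lemma last_in_positions:
  assumes "wf_arena G" "partial_play G h"
  shows "last h \<in> positions G"
  using assms(2,1) by (induction rule: partial_play_induct) (auto simp: wf_arena_def)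

lemma prefix_map_upt: "m \<le> n \<Longrightarrow> prefix (map p [0..<m]) (map p [0..<n])"
  by (metis le0 le_add_diff_inverse map_append prefixI upt_add_eq_append)

lemma prefix_play_Inf:
  assumes "is_play G (Inf p)"
  shows "partial_play G (map p [0..<Suc n])"
  using assms by (auto simp: partial_play_def hd_conv_nth simp del: upt_Suc)

lemma prefix_agrees_Inf:
  assumes "agrees P s (Inf p)"
  shows "agrees P s (Fin (map p [0..<n]))"
proof -
  have "take (Suc i) (map p [0..<n]) = map p [0..<Suc i]" if "Suc i < n" for i
    using that by (simp add: take_map del: upt_Suc)
  then show ?thesis
    using assms by (auto simp del: upt_Suc)
qed

text \<open>Any two members of the chain are comparable, so entry \<open>i\<close> of the limit can
  be read off any member that is long enough.\<close>

lemma chain_limit: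
  fixes H :: "nat \<Rightarrow> 'x list"
  assumes chain: "\<And>n. prefix (H n) (H (Suc n))"
    and unbounded: "\<And>k. \<exists>n. k < length (H n)"
  obtains p where "\<And>n. H n = map p [0..<length (H n)]"
proof -
  have mono: "prefix (H m) (H n)" if "m \<le> n" for m n
    using that by (induction rule: dec_induct) (auto intro: prefix_order.trans chain)
  have nth_eq: "H m ! i = H n ! i" if "i < length (H m)" "i < length (H n)" for m n i
    using mono[of m n] mono[of n m] that by (cases "m \<le> n") (auto simp: prefix_def nth_append)
  define p where "p i = H (SOME n. i < length (H n)) ! i" for i
  have "H n = map p [0..<length (H n)]" for n
  proof (rule nth_equalityI)
    fix i assume i: "i < length (H n)"
    have "i < length (H (SOME n. i < length (H n)))"
      using unbounded by (rule someI_ex)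
    with i have "H n ! i = p i"
      unfolding p_def by (rule nth_eq)
    with i show "H n ! i = map p [0..<length (H n)] ! i" by simp
  qed simp
  then show thesis by (rule that)
qed

text \<open>Being a play and agreeing with a strategy are conditions on single steps, and each step
  of \<open>p\<close> lies inside some \<open>H n\<close>.\<close>

lemma limit_play:
  assumes plays: "\<And>n. partial_play G (H n)" "\<And>n. agrees P s (Fin (H n))"
    and limit: "\<And>n. H n = map p [0..<length (H n)]"
    and unbounded: "\<And>k. \<exists>n. k < length (H n)"
  shows "is_play G (Inf p)" "agrees P s (Inf p)"
proof -
  have "(p i, p (Suc i)) \<in> edges G \<and> p 0 = init_pos G \<and> (p i \<in> P \<longrightarrow> p (Suc i) = s (map p [0..<Suc i]))"
    for i
  proof -
    obtain n where n: "Suc i < length (H n)"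
      using unbounded by blast
    define k where "k = length (H n)"
    have H: "H n = map p [0..<k]" using limit by (simp add: k_def)
    have "take (Suc i) (map p [0..<k]) = map p [0..<Suc i]"
      using n by (simp add: take_map k_def del: upt_Suc)
    then show ?thesis
      using plays[of n] n unfolding H
      by (auto simp: partial_play_def hd_conv_nth simp del: upt_Suc)
  qed
  then show "is_play G (Inf p)" "agrees P s (Inf p)" by auto
qed

text \<open>Winning a letter game is a statement about infinite plays. A finite letter history is
  therefore prolonged: \<open>s\<close> moves at \<open>P\<close>, arbitrary edges are taken
  elsewhere, so agreement is kept.\<close>

lemma extend_partial_play:
  assumes "partial_play G h" "agrees P s (Fin h)" "is_strategy G P s"
    and no_dead_end: "\<And>h. partial_play G h \<Longrightarrow> \<exists>v. (last h, v) \<in> edges G"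
  obtains p where "is_play G (Inf p)" "agrees P s (Inf p)" "map p [0..<length h] = h"
proof -
  define nxt where "nxt h = (if last h \<in> P then s h else SOME v. (last h, v) \<in> edges G)" for h
  have nxt: "(last h, nxt h) \<in> edges G" if "partial_play G h" for h
  proof (cases "last h \<in> P")
    case True
    then show ?thesis using assms(3) no_dead_end[OF that] that by (auto simp: nxt_def is_strategy_def)
  next
    case False
    then show ?thesis using someI_ex[OF no_dead_end[OF that]] by (simp add: nxt_def)
  qed
  define H where "H n = ((\<lambda>h. h @ [nxt h]) ^^ n) h" for n
  have H_Suc: "H (Suc n) = H n @ [nxt (H n)]" for n
    by (simp add: H_def)
  have H: "partial_play G (H n) \<and> agrees P s (Fin (H n)) \<and> length (H n) = length h + n" for n
  proof (induction n)
    case 0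
    then show ?case using assms by (simp add: H_def del: agrees.simps)
  next
    case (Suc n)
    then have "H n \<noteq> []" by (auto simp: partial_play_def)
    with Suc nxt[of "H n"] show ?case
      by (simp add: H_Suc partial_play_snoc agrees_snoc nxt_def del: agrees.simps)
  qed
  have unbounded: "\<exists>n. k < length (H n)" for k
    using H[of "Suc k"] by (intro exI[of _ "Suc k"]) simp
  obtain p where p: "\<And>n. H n = map p [0..<length (H n)]"
    using chain_limit[of H] unbounded by (auto simp: H_Suc)
  have "map p [0..<length h] = h" using p[of 0] by (simp add: H_def)
  moreover have "is_play G (Inf p)" "agrees P s (Inf p)"
    using limit_play[of G H P s p, OF _ _ p unbounded] H by blast+
  ultimately show thesis by (intro that)
qed


section \<open>Words of infinite plays\<close>

text \<open>\<open>play_word\<close> selects the labelled indices of an infinite play; the word of a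
  prefix is the same selection restricted to the indices below \<open>n\<close>.\<close>

lemma word_of_prefix:
  "word_of G (map p [0..<Suc n])
     = map (\<lambda>i. the (label G (p i, p (Suc i)))) (filter (\<lambda>i. label G (p i, p (Suc i)) \<noteq> None) [0..<n])"
proof (induction n)
  case (Suc n)
  have "map p [0..<Suc (Suc n)] = map p [0..<Suc n] @ [p (Suc n)]" by simp
  then have "word_of G (map p [0..<Suc (Suc n)]) = word_of G (map p [0..<Suc n])
      @ (case label G (last (map p [0..<Suc n]), p (Suc n)) of None \<Rightarrow> [] | Some a \<Rightarrow> [a])"
    by (metis word_of_snoc map_is_Nil_conv upt_eq_Nil_conv not_less_eq_eq le0 nat.distinct(1) Zero_not_Suc)
  with Suc show ?case by (auto split: option.split)
qed simp

text \<open>Beyond the last labelled step the words of the prefixes no longer change.\<close>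

lemma play_word_Inf_FinD:
  assumes "play_word G (Inf p) = Fin w"
  obtains N where "\<And>n. N \<le> n \<Longrightarrow> word_of G (map p [0..<Suc n]) = w"
proof -
  define S where "S = {i. label G (p i, p (Suc i)) \<noteq> None}"
  have fin: "finite S"
    and w: "w = map (\<lambda>i. the (label G (p i, p (Suc i)))) (sorted_list_of_set S)"
    using assms by (auto simp: S_def Let_def split: if_splits)
  obtain N where N: "\<forall>i\<in>S. i < N"
    using fin by (metis finite_nat_set_iff_bounded)
  have "sorted_list_of_set S = filter (\<lambda>i. i \<in> S) [0..<n]" if "N \<le> n" for n
    using N that fin by (intro sorted_distinct_set_unique) (auto intro: sorted_wrt_filter)
  then show thesis
    using that[of N] unfolding word_of_prefix w S_def by simp
qed

lemma filter_enumerate: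
  fixes S :: "nat set"
  assumes "infinite S"
  shows "filter (\<lambda>i. i \<in> S) [0..<n]
    = map (enumerate S) [0..<length (filter (\<lambda>i. i \<in> S) [0..<n])]"
proof (induction n)
  case (Suc n)
  show ?case
  proof (cases "n \<in> S")
    case True
    obtain m where m: "enumerate S m = n"
      using enumerate_Ex[OF assms True] by blast
    \<comment> \<open>Counting from 0, \<open>n\<close> is element number \<open>m\<close>, so the
      elements below it are the first \<open>m\<close> of the enumeration. The list so far thus has
      length \<open>m\<close>, and appending \<open>n\<close> continues the enumeration.\<close>
    have "{i \<in> S. i < n} = enumerate S ` {..<m}"
    proof (intro equalityI subsetI)
      fix i assume i: "i \<in> {i \<in> S. i < n}"
      then obtain k where "enumerate S k = i" using enumerate_Ex[OF assms] by blast
      then show "i \<in> enumerate S ` {..<m}"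
        using i m assms by (auto simp: enumerate_mono_iff)
    qed (use m assms in \<open>auto simp: enumerate_mono_iff enumerate_in_set\<close>)
    moreover have "inj_on (enumerate S) {..<m}"
      using inj_enumerate[OF assms] by (rule inj_on_subset) simp
    ultimately have "card {i \<in> S. i < n} = m"
      by (simp add: card_image)
    moreover have "length (filter (\<lambda>i. i \<in> S) [0..<n]) = card {i \<in> S. i < n}"
      by (subst distinct_card[symmetric]) (auto intro: arg_cong[where f = card])
    ultimately show ?thesis using Suc True m by simp
  qed (use Suc in simp)
qed simp

text \<open>With infinitely many labels, the words of the prefixes are initial segments of
  \<open>w\<close> by \<open>filter_enumerate\<close>, and they exceed every length.\<close>

lemma play_word_Inf_InfD:
  assumes "play_word G (Inf p) = Inf w"
  shows "word_of G (map p [0..<Suc n]) = map w [0..<length (word_of G (map p [0..<Suc n]))]"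
    and "\<exists>n. k < length (word_of G (map p [0..<Suc n]))"
proof -
  define S where "S = {i. label G (p i, p (Suc i)) \<noteq> None}"
  have inf: "infinite S" and w: "w = (\<lambda>n. the (label G (p (enumerate S n), p (Suc (enumerate S n)))))"
    using assms by (auto simp: S_def Let_def split: if_splits)
  define fl where "fl n = filter (\<lambda>i. i \<in> S) [0..<n]" for n
  have word: "word_of G (map p [0..<Suc n]) = map (\<lambda>i. the (label G (p i, p (Suc i)))) (fl n)" for n
    unfolding word_of_prefix fl_def S_def by simp
  have "fl n = map (enumerate S) [0..<length (fl n)]"
    unfolding fl_def by (rule filter_enumerate[OF inf])
  from arg_cong[OF this, of "map (\<lambda>i. the (label G (p i, p (Suc i))))"]
  show "word_of G (map p [0..<Suc n]) = map w [0..<length (word_of G (map p [0..<Suc n]))]"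
    by (simp add: word w o_def del: upt_Suc)
  \<comment> \<open>The first \<open>k + 1\<close> labelled steps all lie below this bound.\<close>
  have "enumerate S ` {..k} \<subseteq> set (fl (Suc (enumerate S k)))"
    using inf by (auto simp: fl_def enumerate_in_set less_Suc_eq_le simp del: upt_Suc)
  then have "card (enumerate S ` {..k}) \<le> card (set (fl (Suc (enumerate S k))))"
    by (intro card_mono) auto
  moreover have "card (enumerate S ` {..k}) = Suc k"
    by (subst card_image) (use inj_enumerate[OF inf] in \<open>auto intro: inj_on_subset\<close>)
  ultimately have "k < length (fl (Suc (enumerate S k)))"
    by (metis Suc_le_eq card_length le_trans)
  then show "\<exists>n. k < length (word_of G (map p [0..<Suc n]))"
    unfolding word by (auto simp del: upt_Suc)
qed


section \<open>Running a game and a letter game in parallel\<close>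

declare agrees.simps [simp del]

section \<open>Edges of the letter games and of the product in a common form\<close>

fun successors :: "'a \<Rightarrow> (rat \<times> 'q) pbf \<Rightarrow> ('q, 'a, 'q) res_pos set" where
  "successors a (Atom y) = {State (snd y)}"
| "successors a (Conj \<phi> \<psi>) = {Resolve a \<phi>, Resolve a \<psi>}"
| "successors a (Disj \<phi> \<psi>) = {Resolve a \<phi>, Resolve a \<psi>}"

text \<open>While a formula is resolved, a product position keeps the position \<open>v\<close> of
  \<open>G\<close> where the letter game keeps the letter, so the letter is discarded.\<close>

fun pair_pos :: "'v \<Rightarrow> ('q, 'a, 'q) res_pos \<Rightarrow> ('v \<times> 'q, 'v, 'q) res_pos" where
  "pair_pos v (State q) = State (v, q)"
| "pair_pos v (Resolve a \<phi>) = Resolve v \<phi>"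

definition take_edge ::
    "('v, 'a) arena \<Rightarrow> ('a, 'q) automaton \<Rightarrow> 'v \<Rightarrow> 'q \<Rightarrow> 'v \<Rightarrow> ('v \<times> 'q, 'v, 'q) res_pos" where
  "take_edge G A v q v' = (case label G (v, v') of
     None \<Rightarrow> State (v', q) | Some a \<Rightarrow> Resolve v' (trans A q a))"

text \<open>\<open>F\<close> says which formulas a player owns: \<open>is_Conj\<close> for Adam, its
  negation for Eve, who thus also gets the atoms. With this parameter one construction serves both
  players.\<close>

definition owned :: "((rat \<times> 'q) pbf \<Rightarrow> bool) \<Rightarrow> 'c set \<Rightarrow> ('s, 'c, 'q) res_pos set" where
  "owned F C = {Resolve c \<phi> |c \<phi>. c \<in> C \<and> F \<phi>}"

lemma Resolve_in_owned [simp]: "Resolve c \<phi> \<in> owned F C \<longleftrightarrow> c \<in> C \<and> F \<phi>"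
  and State_notin_owned [simp]: "State s \<notin> owned F C"
  by (auto simp: owned_def)

definition is_Conj :: "'x pbf \<Rightarrow> bool" where
  "is_Conj \<phi> \<longleftrightarrow> (\<exists>\<psi> \<chi>. \<phi> = Conj \<psi> \<chi>)"

lemma resolve_eve_owned: "resolve_eve C = owned (\<lambda>\<phi>. \<not> is_Conj \<phi>) C"
  by (auto simp: resolve_eve_def owned_def is_Conj_def) (metis pbf.exhaust surj_pair)

lemma resolve_adam_owned: "resolve_adam C = owned is_Conj C"
  by (auto simp: resolve_adam_def owned_def is_Conj_def)

lemma product_init [simp]: "init_pos (product G A) = State (init_pos G, init_state A)"
  and label_product [simp]: "label (product G A) = product_label"
  and letter_init [simp]: "init_pos (letter_arena b A) = State (init_state A)"
  and label_letter [simp]: "label (letter_arena b A) = letter_label"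
  by (simp_all add: product_def letter_arena_def)

lemma letter_edge_State:
  "(State q, y) \<in> edges (letter_arena b A) \<longleftrightarrow> (\<exists>a. y = Resolve a (trans A q a))"
  by (auto simp: letter_arena_def resolve_edges_def)

lemma letter_edge_Resolve:
  "(Resolve a \<phi>, y) \<in> edges (letter_arena b A) \<longleftrightarrow> y \<in> successors a \<phi>"
  by (cases \<phi>) (auto simp: letter_arena_def resolve_edges_def)

lemma product_edge_State:
  "(State (v, q), y) \<in> edges (product G A) \<longleftrightarrow> (\<exists>v'. (v, v') \<in> edges G \<and> y = take_edge G A v q v')"
  by (auto simp: product_def resolve_edges_def take_edge_def split: option.splits)

text \<open>The letter \<open>a\<close> occurs on the right only and can be chosen at will, since
  \<open>pair_pos\<close> discards it. Where a letter history is at hand, its current letter is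
  taken.\<close>

lemma product_edge_Resolve:
  "(Resolve v \<phi>, y) \<in> edges (product G A)
     \<longleftrightarrow> v \<in> positions G \<and> (\<exists>z \<in> successors a \<phi>. y = pair_pos v z)"
  by (cases \<phi>) (auto simp: product_def resolve_edges_def)

lemma successors_nonempty: "\<exists>z. z \<in> successors a \<phi>"
  by (cases \<phi>) auto

text \<open>The successors of one formula carry the same letter, so discarding it loses nothing.
  Hence a product move that follows the combined strategy comes from a letter move that follows
  \<open>\<tau>\<close>.\<close>

lemma pair_pos_inj: "z \<in> successors a \<phi> \<Longrightarrow> z' \<in> successors a \<phi> \<Longrightarrow> pair_pos v z = pair_pos v z' \<Longrightarrow> z = z'"
  by (cases \<phi>) auto

lemma letter_no_dead_end: "\<exists>y. (x, y) \<in> edges (letter_arena b A)"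
  by (cases x) (auto simp: letter_edge_State letter_edge_Resolve successors_nonempty)

text \<open>
  The history \<open>g\<close> of \<open>G\<close> and the history \<open>l\<close> of the letter game behind a history of the product are
  accumulated together.  The letter being read is not visible in a product position; it is kept in
  the last position of \<open>l\<close>.
\<close>

fun split_step ::
    "('v, 'a) arena \<Rightarrow> 'v list \<times> ('q, 'a, 'q) res_pos list \<Rightarrow> ('v \<times> 'q, 'v, 'q) res_pos
       \<Rightarrow> 'v list \<times> ('q, 'a, 'q) res_pos list" where
  "split_step G (g, l) (State (v, q)) = (case last l of
     State q' \<Rightarrow> (g @ [v], l) | Resolve a \<psi> \<Rightarrow> (g, l @ [State q]))"
| "split_step G (g, l) (Resolve v \<phi>) = (case last l of
     State q' \<Rightarrow> (g @ [v], l @ [Resolve (the (label G (last g, v))) \<phi>])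
   | Resolve a \<psi> \<Rightarrow> (g, l @ [Resolve a \<phi>]))"

definition split_play ::
    "('v, 'a) arena \<Rightarrow> ('a, 'q) automaton \<Rightarrow> ('v \<times> 'q, 'v, 'q) res_pos list
       \<Rightarrow> 'v list \<times> ('q, 'a, 'q) res_pos list" where
  "split_play G A h = foldl (split_step G) ([init_pos G], [State (init_state A)]) (tl h)"

lemma split_play_singleton [simp]: "split_play G A [x] = ([init_pos G], [State (init_state A)])"
  by (simp add: split_play_def)

lemma split_play_snoc: "h \<noteq> [] \<Longrightarrow> split_play G A (h @ [y]) = split_step G (split_play G A h) y"
  by (simp add: split_play_def)

section \<open>The combined strategy and its invariant\<close>

text \<open>Used once for Eve and once for Adam: \<open>P\<close> and \<open>F\<close> describe what
  the player owns, \<open>b\<close> selects the letter game. The opponent picks the letters there,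
  so \<open>owned F UNIV\<close> is the whole set of the player's positions. What
  \<open>\<tau>\<close> achieves is expressed by a predicate \<open>Q\<close> in the lemmas on
  outcomes.\<close>

locale parallel_play =
  fixes G :: "('v, 'a) arena" and A :: "('a, 'q) automaton" and b :: bool
    and P :: "'v set" and F :: "(rat \<times> 'q) pbf \<Rightarrow> bool"
    and \<sigma> :: "'v list \<Rightarrow> 'v" and \<tau> :: "('q, 'a, 'q) res_pos list \<Rightarrow> ('q, 'a, 'q) res_pos"
  assumes wf: "wf_arena G"
    and strategy_game: "is_strategy G P \<sigma>"
    and strategy_letter: "is_strategy (letter_arena b A) (owned F UNIV) \<tau>"
begin

abbreviation "\<G> \<equiv> product G A"
abbreviation "\<L> \<equiv> letter_arena b A"
abbreviation "game_part h \<equiv> fst (split_play G A h)"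
abbreviation "letter_part h \<equiv> snd (split_play G A h)"

definition player_pos :: "('v \<times> 'q, 'v, 'q) res_pos set" where
  "player_pos = {State (v, q) |v q. v \<in> P} \<union> owned F (positions G)"

lemma State_in_player_pos [simp]: "State (v, q) \<in> player_pos \<longleftrightarrow> v \<in> P"
  and Resolve_in_player_pos [simp]: "Resolve v \<phi> \<in> player_pos \<longleftrightarrow> v \<in> positions G \<and> F \<phi>"
  by (auto simp: player_pos_def)

definition strategy :: "('v \<times> 'q, 'v, 'q) res_pos list \<Rightarrow> ('v \<times> 'q, 'v, 'q) res_pos" where
  "strategy h = (let (g, l) = split_play G A h in case last l of
     State q \<Rightarrow> take_edge G A (last g) q (\<sigma> g)
   | Resolve a \<phi> \<Rightarrow> pair_pos (last g) (\<tau> l))"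

lemma letter_strategy_successor:
  assumes "partial_play \<L> l" "last l = Resolve a \<phi>" "F \<phi>"
  shows "\<tau> l \<in> successors a \<phi>"
proof -
  have "(last l, \<tau> l) \<in> edges \<L>"
    using strategy_letter[unfolded is_strategy_def, rule_format, of l] assms
      letter_no_dead_end[of "last l" b A] by simp
  with assms(2) show ?thesis by (simp add: letter_edge_Resolve)
qed

text \<open>\<open>G\<close> outputs a letter on entering a formula, the letter game only on leaving
  an atom. While a formula is being resolved, the word of \<open>g\<close> is therefore ahead by the
  pending letter \<open>[a]\<close>. Agreement is a conditional conjunct, so that the rest holds for
  every history of the product.\<close>

definition coupled ::
    "('v \<times> 'q, 'v, 'q) res_pos list \<Rightarrow> 'v list \<Rightarrow> ('q, 'a, 'q) res_pos list \<Rightarrow> bool" where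
  "coupled h g l \<longleftrightarrow> partial_play G g \<and> partial_play \<L> l \<and> last h = pair_pos (last g) (last l)
     \<and> word_of \<G> h = map snd (word_of \<L> l)
     \<and> word_of G g = map fst (word_of \<L> l)
         @ (case last l of State q \<Rightarrow> [] | Resolve a \<phi> \<Rightarrow> [a])
     \<and> (agrees player_pos strategy (Fin h) \<longrightarrow>
          agrees P \<sigma> (Fin g) \<and> agrees (owned F UNIV) \<tau> (Fin l))"

text \<open>The last position of \<open>l\<close> decides what is simulated: an edge of
  \<open>G\<close> at a \<open>State\<close>, a resolution step at a \<open>Resolve\<close>. The
  cases record which of the two histories grows.\<close>

lemma split_play_step [consumes 4, case_names silent letter resolve]:
  assumes "h \<noteq> []" "(last h, y) \<in> edges \<G>" "coupled h g l" and gl: "split_play G A h = (g, l)"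
  obtains
    (silent) q v' where "last l = State q" "(last g, v') \<in> edges G" "label G (last g, v') = None"
      "y = take_edge G A (last g) q v'" "split_play G A (h @ [y]) = (g @ [v'], l)"
  | (letter) q v' a where "last l = State q" "(last g, v') \<in> edges G" "label G (last g, v') = Some a"
      "y = take_edge G A (last g) q v'"
      "split_play G A (h @ [y]) = (g @ [v'], l @ [Resolve a (trans A q a)])"
  | (resolve) a \<phi> z where "last l = Resolve a \<phi>" "z \<in> successors a \<phi>" "y = pair_pos (last g) z"
      "last g \<in> positions G" "split_play G A (h @ [y]) = (g, l @ [z])"
proof -
  have last: "last h = pair_pos (last g) (last l)"
    using assms(3) by (simp add: coupled_def)
  show thesis
  proof (cases "last l")
    case (State q)
    then obtain v' where v': "(last g, v') \<in> edges G" "y = take_edge G A (last g) q v'"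
      using assms(2) last by (auto simp: product_edge_State)
    show thesis
    proof (cases "label G (last g, v')")
      case None
      then show thesis
        using v' State silent by (simp add: split_play_snoc assms(1) gl take_edge_def)
    next
      case (Some a)
      then show thesis
        using v' State letter by (simp add: split_play_snoc assms(1) gl take_edge_def)
    qed
  next
    case (Resolve a \<phi>)
    then obtain z where z: "last g \<in> positions G" "z \<in> successors a \<phi>" "y = pair_pos (last g) z"
      using assms(2) last by (auto simp: product_edge_Resolve[where a = a])
    then have "split_play G A (h @ [y]) = (g, l @ [z])"
      using Resolve by (cases \<phi>) (auto simp: split_play_snoc assms(1) gl)
    with z Resolve resolve show thesis by blast
  qed
qed

lemma coupled_split_play:
  assumes "partial_play \<G> h"
  shows "coupled h (game_part h) (letter_part h)"
  using assms
proof (induction rule: partial_play_induct)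
  case init
  show ?case by (simp add: coupled_def)
next
  case (step h y)
  obtain g l where gl: "split_play G A h = (g, l)" by fastforce
  have h: "h \<noteq> []" using step by (simp add: partial_play_def)
  have "coupled h g l" using step.IH by (simp add: gl)
  then have g: "partial_play G g" and l: "partial_play \<L> l"
    and last: "last h = pair_pos (last g) (last l)"
    and word_h: "word_of \<G> h = map snd (word_of \<L> l)"
    and word_g: "word_of G g = map fst (word_of \<L> l)
         @ (case last l of State q \<Rightarrow> [] | Resolve a \<phi> \<Rightarrow> [a])"
    and agrees: "agrees player_pos strategy (Fin h) \<Longrightarrow>
          agrees P \<sigma> (Fin g) \<and> agrees (owned F UNIV) \<tau> (Fin l)"
    unfolding coupled_def by blast+
  have nonempty: "g \<noteq> []" "l \<noteq> []" using g l by (simp_all add: partial_play_def)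
  have strategy_h: "strategy h = (case last l of
     State q \<Rightarrow> take_edge G A (last g) q (\<sigma> g) | Resolve a \<phi> \<Rightarrow> pair_pos (last g) (\<tau> l))"
    by (simp add: strategy_def gl)
  have agrees_h: "agrees player_pos strategy (Fin h)"
    "last h \<in> player_pos \<Longrightarrow> y = strategy h"
    if "agrees player_pos strategy (Fin (h @ [y]))"
    using that h by (simp_all add: agrees_snoc)
  from h step(2) \<open>coupled h g l\<close> gl show ?case
  proof (cases rule: split_play_step)
    case (silent q v')
    have lasth: "last h = State (last g, q)" and y: "y = State (v', q)"
      using last silent by (simp_all add: take_edge_def)
    have words: "word_of \<G> (h @ [y]) = word_of \<G> h" "word_of G (g @ [v']) = word_of G g"
      using h nonempty lasth silent(3) by (simp_all add: word_of_snoc)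
    have "agrees P \<sigma> (Fin (g @ [v'])) \<and> agrees (owned F UNIV) \<tau> (Fin l)"
      if a: "agrees player_pos strategy (Fin (h @ [y]))"
    proof -
      \<comment> \<open>\<open>take_edge\<close> yields a \<open>State\<close> or a
        \<open>Resolve\<close> according to the label, in both cases with the target of the edge, so
        equal product positions have equal targets.\<close>
      have "v' = \<sigma> g" if "last g \<in> P"
        using agrees_h(2)[OF a] that lasth y silent(1)
        by (auto simp: strategy_h take_edge_def split: option.splits)
      with agrees agrees_h(1)[OF a] nonempty show ?thesis by (simp add: agrees_snoc)
    qed
    then show ?thesis
      unfolding silent(5) fst_conv snd_conv coupled_def words
      using g l silent(1,2) nonempty y word_h word_g by (simp add: partial_play_snoc)
  next
    case (letter q v' a)
    have lasth: "last h = State (last g, q)" and y: "y = Resolve v' (trans A q a)"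
      using last letter by (simp_all add: take_edge_def)
    let ?z = "Resolve a (trans A q a)"
    have words: "word_of \<G> (h @ [y]) = word_of \<G> h" "word_of G (g @ [v']) = word_of G g @ [a]"
      "word_of \<L> (l @ [?z]) = word_of \<L> l"
      using h nonempty lasth letter(1,3) by (simp_all add: word_of_snoc)
    have "agrees P \<sigma> (Fin (g @ [v'])) \<and> agrees (owned F UNIV) \<tau> (Fin (l @ [?z]))"
      if a: "agrees player_pos strategy (Fin (h @ [y]))"
    proof -
      have "v' = \<sigma> g" if "last g \<in> P"
        using agrees_h(2)[OF a] that lasth y letter(1)
        by (auto simp: strategy_h take_edge_def split: option.splits)
      with agrees agrees_h(1)[OF a] nonempty letter(1) show ?thesis by (simp add: agrees_snoc)
    qed
    then show ?thesis
      unfolding letter(5) fst_conv snd_conv coupled_def words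
      using g l letter(1,2) nonempty y word_h word_g
      by (simp add: partial_play_snoc letter_edge_State)
  next
    case (resolve a \<phi> z)
    have lasth: "last h = Resolve (last g) \<phi>"
      using last resolve(1) by simp
    \<comment> \<open>On leaving an atom the letter game outputs the pending letter together with
      the weight that the product outputs; on other resolution steps no word changes.\<close>
    have words: "word_of \<G> (h @ [y]) = map snd (word_of \<L> (l @ [z]))"
      "word_of G g = map fst (word_of \<L> (l @ [z]))
         @ (case z of State q \<Rightarrow> [] | Resolve a \<phi> \<Rightarrow> [a])"
    proof -
      show "word_of \<G> (h @ [y]) = map snd (word_of \<L> (l @ [z]))"
        using h nonempty word_h lasth resolve(1)
        by (cases \<phi>) (auto simp: word_of_snoc)
      show "word_of G g = map fst (word_of \<L> (l @ [z]))
         @ (case z of State q \<Rightarrow> [] | Resolve a \<phi> \<Rightarrow> [a])"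
        using nonempty word_g resolve(1,2)
        by (cases \<phi>) (auto simp: word_of_snoc)
    qed
    have "agrees P \<sigma> (Fin g) \<and> agrees (owned F UNIV) \<tau> (Fin (l @ [z]))"
      if a: "agrees player_pos strategy (Fin (h @ [y]))"
    proof -
      have "z = \<tau> l" if "F \<phi>"
      proof -
        have "pair_pos (last g) z = pair_pos (last g) (\<tau> l)"
          using agrees_h(2)[OF a] that lasth resolve(1,3,4) by (simp add: strategy_h)
        with resolve(2) letter_strategy_successor[OF l resolve(1) that] show ?thesis
          by (rule pair_pos_inj)
      qed
      with agrees agrees_h(1)[OF a] nonempty resolve(1) show ?thesis by (simp add: agrees_snoc)
    qed
    then show ?thesis
      unfolding resolve(5) fst_conv snd_conv coupled_def
      using g l resolve(1-3) nonempty words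
      by (simp add: partial_play_snoc letter_edge_Resolve)
  qed
qed

lemma is_strategy_strategy: "is_strategy \<G> player_pos strategy"
  unfolding is_strategy_def
proof safe
  fix h y assume h: "partial_play \<G> h" "last h \<in> player_pos" "(last h, y) \<in> edges \<G>"
  let ?g = "game_part h" and ?l = "letter_part h"
  have c: "partial_play G ?g" "partial_play \<L> ?l" "last h = pair_pos (last ?g) (last ?l)"
    using coupled_split_play[OF h(1)] by (auto simp: coupled_def)
  show "(last h, strategy h) \<in> edges \<G>"
  proof (cases "last ?l")
    case (State q)
    with c h have "(last ?g, \<sigma> ?g) \<in> edges G"
      using strategy_game by (auto simp: is_strategy_def product_edge_State)
    with c State show ?thesis
      by (auto simp: strategy_def case_prod_beta product_edge_State)
  next
    case (Resolve a \<phi>)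
    with c h letter_strategy_successor[OF c(2) Resolve] show ?thesis
      by (auto simp: strategy_def case_prod_beta product_edge_Resolve[where a = a])
  qed
qed

section \<open>The two histories along an infinite play of the product\<close>

lemma split_play_prefix:
  assumes "is_play \<G> (Inf p)"
  shows "prefix (game_part (map p [0..<Suc n])) (game_part (map p [0..<Suc (Suc n)]))"
    and "prefix (letter_part (map p [0..<Suc n])) (letter_part (map p [0..<Suc (Suc n)]))"
    and "p n = State x \<Longrightarrow> length (game_part (map p [0..<Suc (Suc n)])) = Suc (length (game_part (map p [0..<Suc n])))"
proof -
  let ?h = "map p [0..<Suc n]"
  have h: "?h \<noteq> []" "(last ?h, p (Suc n)) \<in> edges \<G>" using assms by auto
  have c: "coupled ?h (game_part ?h) (letter_part ?h)"
    using prefix_play_Inf[OF assms] by (rule coupled_split_play)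
  have snoc: "map p [0..<Suc (Suc n)] = ?h @ [p (Suc n)]" by simp
  have last: "p n = pair_pos (last (game_part ?h)) (last (letter_part ?h))"
    using c by (simp add: coupled_def)
  show "prefix (game_part ?h) (game_part (map p [0..<Suc (Suc n)]))"
    "prefix (letter_part ?h) (letter_part (map p [0..<Suc (Suc n)]))"
    "p n = State x \<Longrightarrow> length (game_part (map p [0..<Suc (Suc n)])) = Suc (length (game_part ?h))"
    unfolding snoc
    by (cases rule: split_play_step[OF h c prod.collapse[symmetric]]; use last in \<open>simp del: upt_Suc\<close>)+
qed

text \<open>Each resolution step passes to an immediate subformula, and an atom leads back to a
  \<open>State\<close>; hence structural induction on the formula.\<close>

lemma State_reached:
  assumes "is_play \<G> (Inf p)"
  shows "\<exists>m\<ge>n. \<exists>x. p m = State x"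
proof -
  have step: "(p n, p (Suc n)) \<in> edges \<G>" for n using assms by simp
  have "\<exists>m\<ge>n. \<exists>x. p m = State x" if "p n = Resolve v \<phi>" for v \<phi>
    using that
  proof (induction \<phi> arbitrary: n)
    case (Atom y)
    \<comment> \<open>No letter history is involved here, so an arbitrary letter instantiates
      \<open>a\<close>.\<close>
    then show ?case using step[of n]
      by (auto simp: product_edge_Resolve[where a = "undefined :: 'a"] intro!: exI[of _ "Suc n"])
  next
    case (Conj \<phi> \<psi>)
    then have "p (Suc n) = Resolve v \<phi> \<or> p (Suc n) = Resolve v \<psi>"
      using step[of n] by (auto simp: product_edge_Resolve[where a = "undefined :: 'a"])
    with Conj.IH show ?case by (meson Suc_leD)
  next
    case (Disj \<phi> \<psi>)
    then have "p (Suc n) = Resolve v \<phi> \<or> p (Suc n) = Resolve v \<psi>"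
      using step[of n] by (auto simp: product_edge_Resolve[where a = "undefined :: 'a"])
    with Disj.IH show ?case by (meson Suc_leD)
  qed
  then show ?thesis by (cases "p n") auto
qed

lemma game_part_mono:
  assumes "is_play \<G> (Inf p)" "n \<le> m"
  shows "length (game_part (map p [0..<Suc n])) \<le> length (game_part (map p [0..<Suc m]))"
  using assms(2)
proof (induction rule: dec_induct)
  case (step i)
  then show ?case using prefix_length_le[OF split_play_prefix(1)[OF assms(1), of i]] by linarith
qed simp

text \<open>Every move out of a \<open>State\<close> extends the history of \<open>G\<close>, and
  such moves recur forever. The bound holds from \<open>M\<close> on, so that it can be combined
  with other bounds.\<close>

lemma game_part_unbounded:
  assumes "is_play \<G> (Inf p)"
  shows "\<exists>M. \<forall>n\<ge>M. k < length (game_part (map p [0..<Suc n]))"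
proof (induction k)
  case 0
  have "partial_play G (game_part (map p [0..<Suc n]))" for n
    using coupled_split_play[OF prefix_play_Inf[OF assms]] unfolding coupled_def by blast
  then show ?case unfolding partial_play_def by blast
next
  case (Suc k)
  then obtain n where n: "k < length (game_part (map p [0..<Suc n]))" by blast
  obtain m x where m: "n \<le> m" "p m = State x" using State_reached[OF assms] by blast
  have "Suc k < length (game_part (map p [0..<Suc (Suc m)]))"
    using n split_play_prefix(3)[OF assms m(2)] game_part_mono[OF assms m(1)] by linarith
  then show ?case
    using game_part_mono[OF assms] by (meson less_le_trans)
qed

text \<open>Only the history of \<open>G\<close> always has an infinite limit; the letter history
  stops growing when just finitely many letters are read.\<close>

lemma game_limit:
  assumes "is_play \<G> (Inf p)" "agrees player_pos strategy (Inf p)"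
  obtains g where "is_play G (Inf g)" "agrees P \<sigma> (Inf g)"
    "\<And>n. game_part (map p [0..<Suc n]) = map g [0..<length (game_part (map p [0..<Suc n]))]"
proof -
  let ?H = "\<lambda>n. game_part (map p [0..<Suc n])"
  have unbounded: "\<exists>n. k < length (?H n)" for k
    using game_part_unbounded[OF assms(1)] by blast
  obtain g where g: "\<And>n. ?H n = map g [0..<length (?H n)]"
    using chain_limit[of ?H, OF split_play_prefix(1)[OF assms(1)] unbounded] by blast
  have "partial_play G (?H n)" "agrees P \<sigma> (Fin (?H n))" for n
    using coupled_split_play[OF prefix_play_Inf[OF assms(1)]] prefix_agrees_Inf[OF assms(2)]
    unfolding coupled_def by blast+
  from limit_play[OF this g unbounded] g that show thesis by blast
qed

section \<open>Transfer of outcomes to the product\<close>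

text \<open>At a \<open>State\<close> no letter is pending, so one word \<open>u\<close> of
  letter-weight pairs describes both plays. Prolonging the letter history to an infinite play makes
  \<open>u\<close> a prefix of some \<open>\<rho>\<close>, and on finite words the letter game tests
  prefixes. These have length \<open>Suc i\<close>, whence the separate alternative
  \<open>Fin []\<close>.\<close>

lemma finite_outcome:
  assumes "on_finite (val_fun A)"
    and letter: "\<And>l. is_play \<L> l \<Longrightarrow> agrees (owned F UNIV) \<tau> l \<Longrightarrow> \<exists>\<rho>. play_word \<L> l = Inf \<rho> \<and> Q \<rho>"
    and h: "partial_play \<G> h" "agrees player_pos strategy (Fin h)" "last h = State x"
  obtains u where "Fin (word_of G (game_part h)) = map_seq fst u" "Fin (word_of \<G> h) = map_seq snd u"
    "u = Fin [] \<or> (\<exists>\<rho>. Q \<rho> \<and> u \<in> tested_words (val_fun A) \<rho>)"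
proof -
  let ?l = "letter_part h" and ?w = "word_of \<L> (letter_part h)"
  have c: "coupled h (game_part h) ?l" using h(1) by (rule coupled_split_play)
  then have l: "partial_play \<L> ?l" "agrees (owned F UNIV) \<tau> (Fin ?l)"
    using h(2) by (auto simp: coupled_def)
  obtain p where p: "is_play \<L> (Inf p)" "agrees (owned F UNIV) \<tau> (Inf p)"
    "map p [0..<length ?l] = ?l"
    using extend_partial_play[OF l strategy_letter letter_no_dead_end] by blast
  obtain \<rho> where \<rho>: "play_word \<L> (Inf p) = Inf \<rho>" "Q \<rho>"
    using letter[OF p(1,2)] by blast
  have "length ?l = Suc (length ?l - 1)" using l(1) by (cases ?l) (auto simp: partial_play_def)
  then have w: "?w = map \<rho> [0..<length ?w]"
    using play_word_Inf_InfD(1)[OF \<rho>(1), of "length ?l - 1"] p(3) by (metis)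
  have "Fin ?w \<in> tested_words (val_fun A) \<rho>" if "?w \<noteq> []"
  proof -
    obtain i where "length ?w = Suc i" using \<open>?w \<noteq> []\<close> by (cases ?w) auto
    with w show ?thesis using assms(1) by (cases "val_fun A") (auto simp del: upt_Suc)
  qed
  moreover have "word_of G (game_part h) = map fst ?w" "word_of \<G> h = map snd ?w"
    using c h(3) by (cases "last ?l"; simp add: coupled_def)+
  ultimately show thesis
    using that[of "Fin ?w"] \<rho>(2) by auto
qed

text \<open>The difference of at most one is the pending letter. It follows that both words are
  finite or both are infinite.\<close>

lemma length_words:
  assumes "partial_play \<G> h"
  shows "length (word_of \<G> h) \<le> length (word_of G (game_part h))"
    and "length (word_of G (game_part h)) \<le> Suc (length (word_of \<G> h))"
  using coupled_split_play[OF assms]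
  by (auto simp: coupled_def split: res_pos.splits)

text \<open>The cases are a finite play, an infinite play with finitely many letters, and one with
  infinitely many. The first two reduce to \<open>finite_outcome\<close>; the third takes limits of
  both histories.\<close>

lemma outcome:
  assumes game: "is_game G f" and fin: "on_finite f \<longleftrightarrow> on_finite (val_fun A)"
    and letter: "\<And>l. is_play \<L> l \<Longrightarrow> agrees (owned F UNIV) \<tau> l \<Longrightarrow> \<exists>\<rho>. play_word \<L> l = Inf \<rho> \<and> Q \<rho>"
    and p: "is_play \<G> p" "agrees player_pos strategy p"
  obtains g u where "is_play G g" "agrees P \<sigma> g"
    "play_word G g = map_seq fst u" "play_word \<G> p = map_seq snd u"
    "u = Fin [] \<or> (\<exists>\<rho>. Q \<rho> \<and> u \<in> tested_words (val_fun A) \<rho>)"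
proof (cases p)
  case (Fin h)
  let ?g = "game_part h" and ?l = "letter_part h"
  have h: "partial_play \<G> h" "agrees player_pos strategy (Fin h)" and dead: "\<And>y. (last h, y) \<notin> edges \<G>"
    using p Fin by auto
  have g: "partial_play G ?g" "agrees P \<sigma> (Fin ?g)" and last: "last h = pair_pos (last ?g) (last ?l)"
    using coupled_split_play[OF h(1)] h(2) by (auto simp: coupled_def)
  \<comment> \<open>A formula always has a successor, so a dead end of the product is a
    \<open>State\<close>, over a dead end of \<open>G\<close>.\<close>
  obtain q where q: "last h = State (last ?g, q)"
  proof (cases "last ?l")
    case (Resolve a \<phi>)
    then have "(last h, pair_pos (last ?g) z) \<in> edges \<G>" if "z \<in> successors a \<phi>" for z
      using last last_in_positions[OF wf g(1)] that
      by (auto simp: product_edge_Resolve[where a = a])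
    with dead successors_nonempty[of a \<phi>] show thesis by blast
  qed (use last that in simp)
  then have play: "is_play G (Fin ?g)"
    using dead g(1) by (auto simp: product_edge_State)
  then have "play_word G (Fin ?g) \<in> word_domain f" using game by (simp only: is_game_def)
  \<comment> \<open>A finite play induces a finite word, so \<open>f\<close>, and with it
    \<open>val_fun A\<close>, is a function on finite words.\<close>
  then have "on_finite (val_fun A)" unfolding fin[symmetric] by (cases f) auto
  from finite_outcome[OF this letter h q] obtain u where
    "Fin (word_of G ?g) = map_seq fst u" "Fin (word_of \<G> h) = map_seq snd u"
    "u = Fin [] \<or> (\<exists>\<rho>. Q \<rho> \<and> u \<in> tested_words (val_fun A) \<rho>)" by blast
  with that[OF play g(2), of u] show thesis by (simp add: Fin word_of_def)
next
  case (Inf p')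
  let ?h = "\<lambda>n. map p' [0..<Suc n]"
  have p': "is_play \<G> (Inf p')" "agrees player_pos strategy (Inf p')" using p Inf by auto
  obtain g where g: "is_play G (Inf g)" "agrees P \<sigma> (Inf g)"
    and g_limit: "\<And>n. game_part (?h n) = map g [0..<length (game_part (?h n))]"
    using game_limit[OF p'] by blast
  have dom: "play_word G (Inf g) \<in> word_domain f" using g(1) game by (simp only: is_game_def)
  note h = prefix_play_Inf[OF p'(1)]
  have c: "coupled (?h n) (game_part (?h n)) (letter_part (?h n))" for n
    using h by (rule coupled_split_play)
  have word_mono: "length (word_of \<G> (?h n)) \<le> length (word_of \<G> (?h m))" if "n \<le> m" for n m
    using that by (intro prefix_length_le prefix_word_of prefix_map_upt) auto
  show thesis
  proof (cases "play_word G (Inf g)")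
    case w: (Fin w)
    then obtain N where N: "\<And>n. N \<le> n \<Longrightarrow> word_of G (map g [0..<Suc n]) = w"
      using play_word_Inf_FinD by blast
    obtain M where M: "\<And>n. M \<le> n \<Longrightarrow> N < length (game_part (?h n))"
      using game_part_unbounded[OF p'(1)] by blast
    have word: "word_of G (game_part (?h n)) = w" if "M \<le> n" for n
      using N[of "length (game_part (?h n)) - 1"] M[OF that] g_limit[of n]
      by (metis Suc_diff_1 less_Suc_eq_le less_zeroE not_gr_zero)
    have finval: "on_finite (val_fun A)" using dom w fin by (cases f) auto
    \<comment> \<open>An infinite weight sequence would outgrow \<open>w\<close>, although the
      product never outputs more weights than \<open>G\<close> outputs letters.\<close>
    obtain x where x: "play_word \<G> (Inf p') = Fin x"
    proof (cases "play_word \<G> (Inf p')")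
      case (Inf x)
      obtain n where "length w < length (word_of \<G> (?h n))"
        using play_word_Inf_InfD(2)[OF Inf] by blast
      then have "length w < length (word_of \<G> (?h (max n M)))"
        using word_mono[of n "max n M"] by linarith
      with length_words(1)[OF h, of "max n M"] word[of "max n M"] show thesis by simp
    qed
    then obtain N' where N': "\<And>n. N' \<le> n \<Longrightarrow> word_of \<G> (?h n) = x"
      using play_word_Inf_FinD by blast
    \<comment> \<open>A moment at which both words are complete and no letter is pending.\<close>
    obtain m y where m: "max M N' \<le> m" "p' m = State y" using State_reached[OF p'(1)] by blast
    have "last (?h m) = State y" using m by simp
    from finite_outcome[OF finval letter h prefix_agrees_Inf[OF p'(2)] this] obtain u where
      "Fin (word_of G (game_part (?h m))) = map_seq fst u" "Fin (word_of \<G> (?h m)) = map_seq snd u"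
      "u = Fin [] \<or> (\<exists>\<rho>. Q \<rho> \<and> u \<in> tested_words (val_fun A) \<rho>)" by blast
    with that[OF g, of u] show thesis using m w x N'[of m] word[of m] Inf by simp
  next
    case w: (Inf w)
    have infval: "\<not> on_finite (val_fun A)" using dom w fin by (cases f) auto
    \<comment> \<open>Stated for any arena, as it is applied to \<open>G\<close> and to the letter
      game.\<close>
    have limit_word: "word_of G' H = map v [0..<length (word_of G' H)]"
      if "play_word G' (Inf r) = Inf v" "H = map r [0..<length H]" "H \<noteq> []"
      for G' :: "('x, 'y) arena" and r H v
      using play_word_Inf_InfD(1)[OF that(1), of "length H - 1"] that(2,3)
      by (metis Suc_diff_1 length_greater_0_conv)
    obtain x where x: "play_word \<G> (Inf p') = Inf x"
    proof (cases "play_word \<G> (Inf p')")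
      case (Fin x)
      then obtain N where N: "\<And>n. N \<le> n \<Longrightarrow> word_of \<G> (?h n) = x"
        using play_word_Inf_FinD by blast
      \<comment> \<open>\<open>Suc\<close> allows for the pending letter: \<open>G\<close> has to be
        ahead by at least two for a contradiction.\<close>
      obtain k where k: "Suc (length x) < length (word_of G (map g [0..<Suc k]))"
        using play_word_Inf_InfD(2)[OF w] by blast
      obtain M where M: "\<And>n. M \<le> n \<Longrightarrow> k < length (game_part (?h n))"
        using game_part_unbounded[OF p'(1)] by blast
      define m where "m = max M N"
      have "prefix (map g [0..<Suc k]) (game_part (?h m))"
        using M[of m] by (subst g_limit) (intro prefix_map_upt, simp add: m_def)
      then have "prefix (word_of G (map g [0..<Suc k])) (word_of G (game_part (?h m)))"
        by (rule prefix_word_of) simp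
      with k have "Suc (length x) < length (word_of G (game_part (?h m)))"
        by (blast dest: prefix_length_le intro: less_le_trans)
      with length_words(2)[OF h, of m] N[of m] show thesis by (simp add: m_def)
    qed
    let ?L = "\<lambda>n. letter_part (?h n)"
    have word: "word_of \<G> (?h n) = map snd (word_of \<L> (?L n))" for n
      using c by (simp only: coupled_def)
    \<comment> \<open>The weights of the product are those of the letter history, which is at least
      as long as its word.\<close>
    have unbounded: "\<exists>n. k < length (?L n)" for k
    proof -
      obtain n where "k < length (word_of \<G> (?h n))"
        using play_word_Inf_InfD(2)[OF x] by blast
      then have "k < length (?L n)"
        using length_word_of_le[of \<L> "?L n"] unfolding word by simp
      then show ?thesis ..
    qed
    obtain l where l_limit: "\<And>n. ?L n = map l [0..<length (?L n)]"
      using chain_limit[of ?L, OF split_play_prefix(2)[OF p'(1)] unbounded] by blast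
    have "partial_play \<L> (?L n)" "agrees (owned F UNIV) \<tau> (Fin (?L n))" for n
      using c[of n] prefix_agrees_Inf[OF p'(2)] unfolding coupled_def by blast+
    from limit_play[OF this l_limit unbounded] obtain \<rho> where
      \<rho>: "play_word \<L> (Inf l) = Inf \<rho>" "Q \<rho>"
      using letter by blast
    \<comment> \<open>For \<open>n\<close> so large that weight \<open>i\<close> has been output,
      letter \<open>i\<close> is no longer pending, and entry \<open>i\<close> can be compared in
      the finite histories.\<close>
    have "w i = fst (\<rho> i) \<and> x i = snd (\<rho> i)" for i
    proof -
      obtain n where n: "i < length (word_of \<G> (?h n))"
        using play_word_Inf_InfD(2)[OF x] by blast
      have nonempty: "game_part (?h n) \<noteq> []" "?L n \<noteq> []"
        using c[of n] by (auto simp: coupled_def partial_play_def)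
      have i: "i < length (word_of \<L> (?L n))" "i < length (word_of G (game_part (?h n)))"
        using n length_words(1)[OF h, of n] by (simp_all add: word del: upt_Suc)
      have "word_of G (game_part (?h n)) ! i = map fst (word_of \<L> (?L n)) ! i"
        using c[of n] i(1) by (simp add: coupled_def nth_append del: upt_Suc)
      moreover have "word_of G (game_part (?h n)) ! i = w i"
        using limit_word[OF w g_limit nonempty(1)] i(2) by (metis nth_map_upt add_0 diff_zero)
      moreover have "word_of \<L> (?L n) ! i = \<rho> i"
        using limit_word[OF \<rho>(1) l_limit nonempty(2)] i(1) by (metis nth_map_upt add_0 diff_zero)
      moreover have "word_of \<G> (?h n) ! i = x i"
        using play_word_Inf_InfD(1)[OF x] n by (metis nth_map_upt add_0 diff_zero)
      ultimately show ?thesis using i(1) by (simp add: word del: upt_Suc)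
    qed
    then have "play_word G (Inf g) = map_seq fst (Inf \<rho>)" "play_word \<G> p = map_seq snd (Inf \<rho>)"
      using w x Inf by (auto simp: fun_eq_iff)
    moreover have "Inf \<rho> \<in> tested_words (val_fun A) \<rho>"
      using infval by (cases "val_fun A") auto
    ultimately show thesis using that[OF g] \<rho>(2) by blast
  qed
qed

end


section \<open>Values\<close>

text \<open>The only play on the empty word stays at the initial position and outputs nothing. This
  settles the word that the letter games do not test.\<close>

lemma aut_value_Nil: "aut_value A (Fin []) = ereal (payoff (val_fun A) (Fin []))"
proof -
  let ?G = "word_game A (Fin [])"
  have dead: "(init_pos ?G, y) \<notin> edges ?G" for y
    by (auto simp: word_game_def product_edge_State word_arena_def)
  have "eve_plays ?G s = {Fin [init_pos ?G]}" for s
  proof (intro equalityI subsetI)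
    fix p assume p: "p \<in> eve_plays ?G s"
    then show "p \<in> {Fin [init_pos ?G]}"
    proof (cases p)
      case (Fin h)
      then have "partial_play ?G h" using p by (simp add: eve_plays_def)
      then have "h = [init_pos ?G]"
        by (induction rule: partial_play_induct) (use dead in auto)
      with Fin show ?thesis by simp
    next
      case (Inf r)
      then show ?thesis using p dead by (auto simp: eve_plays_def) metis
    qed
  qed (auto simp: eve_plays_def dead)
  moreover have "play_word ?G (Fin [init_pos ?G]) = Fin []"
    by (simp add: List.map_filter_def)
  \<comment> \<open>The supremum of a constant is that constant only over a nonempty set.\<close>
  moreover have "eve_strategies ?G \<noteq> {}"
  proof -
    have "(\<lambda>h. SOME v. (last h, v) \<in> edges ?G) \<in> eve_strategies ?G"
      by (auto simp: eve_strategies_def is_strategy_def intro: someI)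
    then show ?thesis by blast
  qed
  ultimately show ?thesis
    by (simp add: aut_value_def game_value_def eve_value_def eve_strategy_value_def)
qed

lemma realizes_outcome:
  assumes "realizes A f" "map_seq fst u \<in> word_domain f"
  shows "aut_value A (map_seq fst u) = ereal (payoff f (map_seq fst u))"
    and "u = Fin [] \<Longrightarrow> payoff f (map_seq fst u) = payoff (val_fun A) (map_seq snd u)"
proof -
  show *: "aut_value A (map_seq fst u) = ereal (payoff f (map_seq fst u))"
    using assms by (simp add: realizes_def)
  show "payoff f (map_seq fst u) = payoff (val_fun A) (map_seq snd u)" if "u = Fin []"
    using * that by (simp add: aut_value_Nil)
qed

text \<open>For \<open>r < t\<close> some strategy in \<open>G\<close> guarantees more than
  \<open>r\<close>. Combined with a winning strategy of the \<open>r\<close>-threshold letter game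
  it guarantees at least \<open>r\<close> in the product.\<close>

lemma eve_value_product_ge:
  assumes A: "realizes A f" and game: "is_game G f"
    and hd: "\<And>r. eve_wins_eves_letter_game r A"
    and t: "ereal t \<le> eve_value G f"
  shows "ereal t \<le> eve_value (product G A) (val_fun A)"
proof (rule ccontr)
  assume "\<not> ?thesis"
  \<comment> \<open>Placing \<open>r\<close> strictly below \<open>t\<close> yields a strategy worth
    more than \<open>r\<close> even if the supremum is not attained; placing it above the value of
    the product gives the contradiction.\<close>
  then obtain r where r: "eve_value (product G A) (val_fun A) < ereal r" "ereal r < ereal t"
    using ereal_dense2[of "eve_value (product G A) (val_fun A)" "ereal t"] by (auto simp: not_le)
  from r(2) t have "ereal r < eve_value G f" by (rule less_le_trans)
  then obtain \<sigma> where \<sigma>: "\<sigma> \<in> eve_strategies G" "ereal r < eve_strategy_value G f \<sigma>"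
    by (auto simp: eve_value_def less_SUP_iff)
  obtain \<tau> where \<tau>: "\<tau> \<in> eve_strategies (letter_arena True A)"
    "\<And>p. p \<in> eve_plays (letter_arena True A) \<tau> \<Longrightarrow>
        \<exists>\<rho>. play_word (letter_arena True A) p = Inf \<rho> \<and> eve_wins_letter_play r A \<rho>"
    using hd[of r] by (auto simp: eve_wins_eves_letter_game_def)
  have letter_pos: "eve_pos (letter_arena True A) = owned (\<lambda>\<phi>. \<not> is_Conj \<phi>) UNIV"
    by (simp add: letter_arena_def resolve_eve_owned)
  interpret parallel_play G A True "eve_pos G" "\<lambda>\<phi>. \<not> is_Conj \<phi>" \<sigma> \<tau>
    using game \<sigma>(1) \<tau>(1)
    by unfold_locales (simp_all only: is_game_def eve_strategies_def letter_pos mem_Collect_eq)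
  have fin: "on_finite f \<longleftrightarrow> on_finite (val_fun A)"
    using A by (simp add: realizes_def)
  have letter: "\<exists>\<rho>. play_word \<L> l = Inf \<rho> \<and> eve_wins_letter_play r A \<rho>"
    if "is_play \<L> l" "agrees (owned (\<lambda>\<phi>. \<not> is_Conj \<phi>) UNIV) \<tau> l" for l
    using \<tau>(2) that by (simp add: eve_plays_def letter_pos)
  have product_pos: "eve_pos \<G> = player_pos"
    by (simp add: product_def player_pos_def resolve_eve_owned)
  have "ereal r \<le> ereal (payoff (val_fun A) (play_word \<G> p))" if p: "p \<in> eve_plays \<G> strategy" for p
  proof -
    have play: "is_play \<G> p" "agrees player_pos strategy p"
      using p by (simp_all add: eve_plays_def product_pos)
    obtain g u where g: "is_play G g" "agrees (eve_pos G) \<sigma> g"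
      "play_word G g = map_seq fst u" "play_word \<G> p = map_seq snd u"
      "u = Fin [] \<or> (\<exists>\<rho>. eve_wins_letter_play r A \<rho> \<and> u \<in> tested_words (val_fun A) \<rho>)"
      by (rule outcome[OF game fin letter play])
    have "eve_strategy_value G f \<sigma> \<le> ereal (payoff f (play_word G g))"
      unfolding eve_strategy_value_def using g(1,2) by (intro INF_lower) (simp add: eve_plays_def)
    with \<sigma>(2) have word_value: "ereal r < ereal (payoff f (map_seq fst u))"
      unfolding g(3) by (rule less_le_trans)
    have "map_seq fst u \<in> word_domain f"
      using game g(1,3) by (metis is_game_def)
    note realized = realizes_outcome[OF A this]
    from g(5) have "r \<le> payoff (val_fun A) (map_seq snd u)"
    proof (elim disjE exE conjE)
      assume "u = Fin []"
      from realized(2)[OF this] word_value show ?thesis by simp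
    next
      fix \<rho> assume "eve_wins_letter_play r A \<rho>" "u \<in> tested_words (val_fun A) \<rho>"
      then have "ereal r \<le> aut_value A (map_seq fst u) \<longrightarrow> r \<le> payoff (val_fun A) (map_seq snd u)"
        unfolding eve_wins_letter_play_def by (rule bspec)
      with realized(1) word_value show ?thesis by simp
    qed
    then show ?thesis unfolding g(4) by simp
  qed
  then have "ereal r \<le> eve_strategy_value \<G> (val_fun A) strategy"
    unfolding eve_strategy_value_def by (rule INF_greatest)
  also have "\<dots> \<le> eve_value \<G> (val_fun A)"
    unfolding eve_value_def
    using is_strategy_strategy by (intro SUP_upper) (simp add: eve_strategies_def product_pos)
  finally show False using r(1) by simp
qed

lemma adam_value_product_less:
  assumes A: "realizes A f" and game: "is_game G f"
    and hd: "\<And>r. adam_wins_adams_letter_game r A"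
    and t: "adam_value G f < ereal t"
  shows "adam_value (product G A) (val_fun A) < ereal t"
proof -
  obtain \<sigma> where \<sigma>: "\<sigma> \<in> adam_strategies G" "adam_strategy_value G f \<sigma> < ereal t"
    using t by (auto simp: adam_value_def INF_less_iff)
  \<comment> \<open>Payoffs strictly below \<open>r\<close> only bound their supremum by
    \<open>r\<close>, so strictness has to come from \<open>r < t\<close>.\<close>
  obtain r where r: "adam_strategy_value G f \<sigma> < ereal r" "ereal r < ereal t"
    using ereal_dense2[OF \<sigma>(2)] by blast
  obtain \<tau> where \<tau>: "\<tau> \<in> adam_strategies (letter_arena False A)"
    "\<And>p. p \<in> adam_plays (letter_arena False A) \<tau> \<Longrightarrow>
        \<exists>\<rho>. play_word (letter_arena False A) p = Inf \<rho> \<and> adam_wins_letter_play r A \<rho>"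
    using hd[of r] by (auto simp: adam_wins_adams_letter_game_def)
  have letter_pos: "adam_pos (letter_arena False A) = owned is_Conj UNIV"
    by (simp add: letter_arena_def resolve_adam_owned)
  interpret parallel_play G A False "adam_pos G" is_Conj \<sigma> \<tau>
    using game \<sigma>(1) \<tau>(1)
    by unfold_locales (simp_all only: is_game_def adam_strategies_def letter_pos mem_Collect_eq)
  have fin: "on_finite f \<longleftrightarrow> on_finite (val_fun A)"
    using A by (simp add: realizes_def)
  have letter: "\<exists>\<rho>. play_word \<L> l = Inf \<rho> \<and> adam_wins_letter_play r A \<rho>"
    if "is_play \<L> l" "agrees (owned is_Conj UNIV) \<tau> l" for l
    using \<tau>(2) that by (simp add: adam_plays_def letter_pos)
  have product_pos: "adam_pos \<G> = player_pos"
    by (simp add: product_def player_pos_def resolve_adam_owned)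
  have "ereal (payoff (val_fun A) (play_word \<G> p)) \<le> ereal r" if p: "p \<in> adam_plays \<G> strategy" for p
  proof -
    have play: "is_play \<G> p" "agrees player_pos strategy p"
      using p by (simp_all add: adam_plays_def product_pos)
    obtain g u where g: "is_play G g" "agrees (adam_pos G) \<sigma> g"
      "play_word G g = map_seq fst u" "play_word \<G> p = map_seq snd u"
      "u = Fin [] \<or> (\<exists>\<rho>. adam_wins_letter_play r A \<rho> \<and> u \<in> tested_words (val_fun A) \<rho>)"
      by (rule outcome[OF game fin letter play])
    have "ereal (payoff f (play_word G g)) \<le> adam_strategy_value G f \<sigma>"
      unfolding adam_strategy_value_def using g(1,2) by (intro SUP_upper) (simp add: adam_plays_def)
    from this r(1) have word_value: "ereal (payoff f (map_seq fst u)) < ereal r"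
      unfolding g(3) by (rule le_less_trans)
    have "map_seq fst u \<in> word_domain f"
      using game g(1,3) by (metis is_game_def)
    note realized = realizes_outcome[OF A this]
    from g(5) have "payoff (val_fun A) (map_seq snd u) < r"
    proof (elim disjE exE conjE)
      assume "u = Fin []"
      from realized(2)[OF this] word_value show ?thesis by simp
    next
      fix \<rho> assume "adam_wins_letter_play r A \<rho>" "u \<in> tested_words (val_fun A) \<rho>"
      then have "aut_value A (map_seq fst u) < ereal r \<longrightarrow> payoff (val_fun A) (map_seq snd u) < r"
        unfolding adam_wins_letter_play_def by (rule bspec)
      with realized(1) word_value show ?thesis by simp
    qed
    then show ?thesis unfolding g(4) by simp
  qed
  then have "adam_strategy_value \<G> (val_fun A) strategy \<le> ereal r"
    unfolding adam_strategy_value_def by (rule SUP_least)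
  moreover have "adam_value \<G> (val_fun A) \<le> adam_strategy_value \<G> (val_fun A) strategy"
    unfolding adam_value_def
    using is_strategy_strategy by (intro INF_lower) (simp add: adam_strategies_def product_pos)
  ultimately show ?thesis using r(2) by order
qed

theorem lemma6:
  fixes A :: "('a::finite, 'q::finite) automaton"
    and f :: "'a wordfun"
  assumes "realizes A f"
    and "threshold_history_deterministic A"
  shows "good_for_threshold_games TYPE('v) A f"
  unfolding good_for_threshold_games_def good_for_t_threshold_games_def
proof (intro allI impI, elim conjE)
  fix t and G :: "('v, 'a) arena"
  assume game: "is_game G f" and det: "determined G f" "determined (product G A) (val_fun A)"
  have hd: "eve_wins_eves_letter_game r A" "adam_wins_adams_letter_game r A" for r
    using assms(2)
    by (auto simp: threshold_history_deterministic_def t_threshold_history_deterministic_def)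
  \<comment> \<open>One direction is Eve's bound. The other is the contrapositive of Adam's, as
    determinacy identifies \<open>eve_value\<close> with \<open>adam_value\<close> in both
    games.\<close>
  show "eve_wins_threshold t G f \<longleftrightarrow> eve_wins_threshold t (product G A) (val_fun A)"
    using eve_value_product_ge[OF assms(1) game hd(1), of t]
      adam_value_product_less[OF assms(1) game hd(2), of t] det
    by (auto simp: eve_wins_threshold_def game_value_def determined_def not_le[symmetric])
qed

end
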